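(* Let $L$ be a set, let $((X_n,\alpha_n))_{n\in\mathbb{N}}$ be a sequence of $L$-labeled metric spaces and let $(X,\alpha)$ be an $L$-labeled metric space. Then $((X_n,\alpha_n))_{n\in\mathbb{N}}$ converges to $(X,\alpha)$, i.e. $\lim_{n\to\infty}d_{GH}^L(X_n,\alpha_n;X,\alpha)=0$, if and only if there exist a sequence $(\varepsilon_n)_{n\in\mathbb{N}}$ of positive real numbers and a sequence of maps $f_n\colon X_n\to X$ such that every $f_n$ is an $(\varepsilon_n,L)$-isometry and $\varepsilon_n\to 0$.
   Context: All metric spaces are assumed to be compact. Given a set $L$, an $L$-labeled metric space is a pair $(X,\alpha)$ where $X$ is a (compact) metric space and $\alpha\colon L\to X$ is an arbitrary map (a labeling). For $L$-labeled metric spaces $(X,\alpha)$, $(Y,\beta)$ and $t\ge 0$, a pseudometric $d\colon (X\sqcup Y)^2\to[0,\infty)$ on the disjoint union is called $(t,L)$-admissible if (1) $d|_{X\times X}=d_X$ and $d|_{Y\times Y}=d_Y$; (2) $d_H(X,Y)\le t$, where $d_H$ is the Hausdorff distance with respect to $d$; (3) $\sup_{\ell\in L}d(\alpha(\ell),\beta(\ell))\le t$ (with $\sup\varnothing=0$). The labeled Gromov-Hausdorff (LGH) distance is $$d_{GH}^L(X,\alpha;Y,\beta):=\inf\{t : \text{there exists a } (t,L)\text{-admissible pseudometric on } X\sqcup Y\}.$$ The distortion of a map $f\colon X\to Y$ is $\operatorname{dis} f=\sup\{|d_X(x,x')-d_Y(f(x),f(x'))| : x,x'\in X\}$. For $\varepsilon>0$,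 a subset $S\subseteq Y$ is an $\varepsilon$-net in $Y$ if for every $y\in Y$ there is $s\in S$ with $d_Y(s,y)<\varepsilon$. A (not necessarily continuous) map $f\colon X\to Y$ between $L$-labeled metric spaces $(X,\alpha)$, $(Y,\beta)$ is an $(\varepsilon,L)$-isometry if (1) $\operatorname{dis} f<\varepsilon$; (2) $\sup_{\ell\in L}d_Y(f(\alpha(\ell)),\beta(\ell))<\varepsilon$; (3) $f(X)$ is an $\varepsilon$-net in $Y$. *)

theory Defs
  imports "HOL-Analysis.Analysis"
begin

text \<open>
  Suprema and infima of distances are taken in \<^typ>\<open>ennreal\<close>: there the supremum of the empty
  family is 0, the infimum of the empty family is \<open>\<infinity>\<close>, and unbounded families have supremum
  \<open>\<infinity>\<close>, so no junk values occur.
\<close>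

text \<open>
  Metric spaces are nonempty, as usual in this setting: the Hausdorff distance is only a number for
  nonempty sets, and between an empty and a nonempty space there is no \<open>(\<epsilon>,L)\<close>-isometry
  for any \<open>\<epsilon>\<close>.
\<close>

definition labeled_metric_space :: "'l set \<Rightarrow> 'a metric \<Rightarrow> ('l \<Rightarrow> 'a) \<Rightarrow> bool" where
  "labeled_metric_space L X \<alpha> \<longleftrightarrow>
     mspace X \<noteq> {} \<and> compact_space (mtopology_of X) \<and> \<alpha> \<in> L \<rightarrow> mspace X"

definition pseudometric_on :: "'a set \<Rightarrow> ('a \<Rightarrow> 'a \<Rightarrow> real) \<Rightarrow> bool" where
  "pseudometric_on S d \<longleftrightarrow>
     (\<forall>x\<in>S. \<forall>y\<in>S. 0 \<le> d x y) \<and>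
     (\<forall>x\<in>S. d x x = 0) \<and>
     (\<forall>x\<in>S. \<forall>y\<in>S. d x y = d y x) \<and>
     (\<forall>x\<in>S. \<forall>y\<in>S. \<forall>z\<in>S. d x z \<le> d x y + d y z)"

definition hausdorff_distance :: "('a \<Rightarrow> 'a \<Rightarrow> real) \<Rightarrow> 'a set \<Rightarrow> 'a set \<Rightarrow> ennreal" where
  "hausdorff_distance d A B =
     max (SUP a\<in>A. INF b\<in>B. ennreal (d a b)) (SUP b\<in>B. INF a\<in>A. ennreal (d a b))"

text \<open>
  The disjoint union of \<open>X\<close> and \<open>Y\<close> is \<^term>\<open>mspace X <+> mspace Y\<close>, with \<^const>\<open>Inl\<close> and
  \<^const>\<open>Inr\<close> as the inclusions.
\<close>

definition admissible ::
  "real \<Rightarrow> 'l set \<Rightarrow> 'a metric \<Rightarrow> ('l \<Rightarrow> 'a) \<Rightarrow> 'b metric \<Rightarrow> ('l \<Rightarrow> 'b) \<Rightarrow>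
    ('a + 'b \<Rightarrow> 'a + 'b \<Rightarrow> real) \<Rightarrow> bool" where
  "admissible t L X \<alpha> Y \<beta> d \<longleftrightarrow>
     pseudometric_on (mspace X <+> mspace Y) d \<and>
     (\<forall>x\<in>mspace X. \<forall>x'\<in>mspace X. d (Inl x) (Inl x') = mdist X x x') \<and>
     (\<forall>y\<in>mspace Y. \<forall>y'\<in>mspace Y. d (Inr y) (Inr y') = mdist Y y y') \<and>
     hausdorff_distance d (Inl ` mspace X) (Inr ` mspace Y) \<le> ennreal t \<and>
     (SUP l\<in>L. ennreal (d (Inl (\<alpha> l)) (Inr (\<beta> l)))) \<le> ennreal t"

definition LGH_distance ::
  "'l set \<Rightarrow> 'a metric \<Rightarrow> ('l \<Rightarrow> 'a) \<Rightarrow> 'b metric \<Rightarrow> ('l \<Rightarrow> 'b) \<Rightarrow> ennreal" where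
  "LGH_distance L X \<alpha> Y \<beta> =
     Inf (ennreal ` {t. 0 \<le> t \<and> (\<exists>d. admissible t L X \<alpha> Y \<beta> d)})"

definition distortion :: "'a metric \<Rightarrow> 'b metric \<Rightarrow> ('a \<Rightarrow> 'b) \<Rightarrow> ennreal" where
  "distortion X Y f =
     (SUP (x, x') \<in> mspace X \<times> mspace X. ennreal \<bar>mdist X x x' - mdist Y (f x) (f x')\<bar>)"

definition eps_net :: "real \<Rightarrow> 'a metric \<Rightarrow> 'a set \<Rightarrow> bool" where
  "eps_net \<epsilon> Y S \<longleftrightarrow> S \<subseteq> mspace Y \<and> (\<forall>y\<in>mspace Y. \<exists>s\<in>S. mdist Y s y < \<epsilon>)"

definition eps_isometry ::
  "real \<Rightarrow> 'l set \<Rightarrow> 'a metric \<Rightarrow> ('l \<Rightarrow> 'a) \<Rightarrow> 'b metric \<Rightarrow> ('l \<Rightarrow> 'b) \<Rightarrow> ('a \<Rightarrow> 'b) \<Rightarrow> bool" where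
  "eps_isometry \<epsilon> L X \<alpha> Y \<beta> f \<longleftrightarrow>
     f \<in> mspace X \<rightarrow> mspace Y \<and>
     distortion X Y f < ennreal \<epsilon> \<and>
     (SUP l\<in>L. ennreal (mdist Y (f (\<alpha> l)) (\<beta> l))) < ennreal \<epsilon> \<and>
     eps_net \<epsilon> Y (f ` mspace X)"

end

theory Submission
  imports Defs
begin

text \<open>
  An admissible pseudometric with parameter \<open>s < t\<close> yields a \<open>(3t,L)\<close>-isometry by sending each point
  of \<open>X\<close> to a \<open>t\<close>-close point of \<open>Y\<close>. Conversely, an \<open>(\<epsilon>,L)\<close>-isometry \<open>f\<close> yields an admissible
  pseudometric with parameter \<open>2\<epsilon>\<close>, by joining every \<open>u\<close> to \<open>f u\<close> with a bridge of length \<open>\<epsilon>\<close>.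
\<close>

lemma mdist_same: "x \<in> mspace X \<Longrightarrow> mdist X x x = 0"
  by (simp add: Metric_space.zero[OF Metric_space_mspace_mdist])

section \<open>From an admissible pseudometric to an approximate isometry\<close>

lemma eps_isometry_if_LGH_distance_less:
  fixes X :: "'a metric" and Y :: "'b metric"
  assumes \<alpha>: "\<alpha> \<in> L \<rightarrow> mspace X" and \<beta>: "\<beta> \<in> L \<rightarrow> mspace Y"
    and less: "LGH_distance L X \<alpha> Y \<beta> < ennreal t"
  shows "\<exists>f. eps_isometry (3 * t) L X \<alpha> Y \<beta> f"
proof -
  obtain s d where "0 \<le> s" and st: "ennreal s < ennreal t" and adm: "admissible s L X \<alpha> Y \<beta> d"
    using less unfolding LGH_distance_def Inf_less_iff by auto
  have s_less: "s < t"
    using st \<open>0 \<le> s\<close> by (simp add: ennreal_less_iff)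
  then have "0 < t" using \<open>0 \<le> s\<close> by linarith
  have pm: "pseudometric_on (mspace X <+> mspace Y) d"
    and dX: "\<And>x x'. x \<in> mspace X \<Longrightarrow> x' \<in> mspace X \<Longrightarrow> d (Inl x) (Inl x') = mdist X x x'"
    and dY: "\<And>y y'. y \<in> mspace Y \<Longrightarrow> y' \<in> mspace Y \<Longrightarrow> d (Inr y) (Inr y') = mdist Y y y'"
    and haus: "hausdorff_distance d (Inl ` mspace X) (Inr ` mspace Y) \<le> ennreal s"
    and lab: "(SUP l\<in>L. ennreal (d (Inl (\<alpha> l)) (Inr (\<beta> l)))) \<le> ennreal s"
    using adm unfolding admissible_def by auto
  have sym: "d u v = d v u" if "u \<in> mspace X <+> mspace Y" "v \<in> mspace X <+> mspace Y" for u v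
    using pm that unfolding pseudometric_on_def by blast
  have tri: "d u w \<le> d u v + d v w"
    if "u \<in> mspace X <+> mspace Y" "v \<in> mspace X <+> mspace Y" "w \<in> mspace X <+> mspace Y" for u v w
    using pm that unfolding pseudometric_on_def by blast
  \<comment> \<open>The Hausdorff bound only says that an infimum is at most \<open>s\<close>. The
    gap \<open>s < t\<close> turns this into an actual point at distance below
    \<open>t\<close>.\<close>
  have near: "\<exists>y\<in>mspace Y. d (Inl x) (Inr y) < t" if "x \<in> mspace X" for x
  proof -
    have "(INF b\<in>Inr ` mspace Y. ennreal (d (Inl x) b)) \<le> ennreal s"
      using haus that unfolding hausdorff_distance_def by (auto simp: SUP_le_iff)
    then have "(INF b\<in>Inr ` mspace Y. ennreal (d (Inl x) b)) < ennreal t"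
      using st by (rule le_less_trans)
    then show ?thesis
      unfolding INF_less_iff by (metis (no_types, lifting) ennreal_leI image_iff leD not_le_imp_less)
  qed
  have near': "\<exists>x\<in>mspace X. d (Inl x) (Inr y) < t" if "y \<in> mspace Y" for y
  proof -
    have "(INF a\<in>Inl ` mspace X. ennreal (d a (Inr y))) \<le> ennreal s"
      using haus that unfolding hausdorff_distance_def by (auto simp: SUP_le_iff)
    then have "(INF a\<in>Inl ` mspace X. ennreal (d a (Inr y))) < ennreal t"
      using st by (rule le_less_trans)
    then show ?thesis
      unfolding INF_less_iff by (metis (no_types, lifting) ennreal_leI image_iff leD not_le_imp_less)
  qed
  have lab_le: "d (Inl (\<alpha> l)) (Inr (\<beta> l)) \<le> s" if "l \<in> L" for l
    using lab that \<open>0 \<le> s\<close> by (auto simp: SUP_le_iff)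
  from near obtain f where fY: "\<And>x. x \<in> mspace X \<Longrightarrow> f x \<in> mspace Y"
    and f_near: "\<And>x. x \<in> mspace X \<Longrightarrow> d (Inl x) (Inr (f x)) < t"
    by metis
  \<comment> \<open>The detour from \<open>f x\<close> to \<open>y\<close> through \<open>x\<close>.
    This one estimate serves the distortion, the labels and the net.\<close>
  have dist_le: "mdist Y (f x) y \<le> t + d (Inl x) (Inr y)"
    if "x \<in> mspace X" "y \<in> mspace Y" for x y
    using tri[of "Inr (f x)" "Inl x" "Inr y"] sym[of "Inr (f x)" "Inl x"] f_near[of x] fY[of x] dY[of "f x" y] that
    by (simp add: InlI InrI)
  have dis: "\<bar>mdist X x x' - mdist Y (f x) (f x')\<bar> \<le> 2 * t" if "x \<in> mspace X" "x' \<in> mspace X" for x x'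
  proof -
    \<comment> \<open>In the quadrilateral \<open>x\<close>, \<open>f x\<close>,
      \<open>f x'\<close>, \<open>x'\<close> the sides joining a point to its image are shorter than
      \<open>t\<close>, so the other two sides differ by at most \<open>2 * t\<close>.\<close>
    note in_union = that fY[OF that(1)] fY[OF that(2)]
    have "d (Inl x) (Inl x') \<le> d (Inl x) (Inr (f x)) + d (Inr (f x)) (Inl x')"
      "d (Inr (f x)) (Inl x') \<le> d (Inr (f x)) (Inr (f x')) + d (Inr (f x')) (Inl x')"
      "d (Inl x) (Inr (f x')) \<le> d (Inl x) (Inl x') + d (Inl x') (Inr (f x'))"
      "d (Inr (f x')) (Inl x') = d (Inl x') (Inr (f x'))"
      using in_union by (auto intro: tri sym)
    with f_near[OF that(1)] f_near[OF that(2)] dist_le[of x "f x'"] dX[of x x'] dY[of "f x" "f x'"] in_union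
    show ?thesis by simp
  qed
  have "distortion X Y f \<le> ennreal (2 * t)"
    unfolding distortion_def using dis by (auto intro!: SUP_least ennreal_leI)
  moreover have "(SUP l\<in>L. ennreal (mdist Y (f (\<alpha> l)) (\<beta> l))) \<le> ennreal (2 * t)"
  proof (intro SUP_least ennreal_leI)
    fix l assume "l \<in> L"
    then show "mdist Y (f (\<alpha> l)) (\<beta> l) \<le> 2 * t"
      using dist_le[of "\<alpha> l" "\<beta> l"] lab_le[of l] s_less \<alpha> \<beta> by fastforce
  qed
  \<comment> \<open>Passing to suprema leaves only a weak bound by \<open>2 * t\<close>; the third
    \<open>t\<close> restores the strict inequalities that \<open>eps_isometry\<close>
    demands.\<close>
  moreover have "ennreal (2 * t) < ennreal (3 * t)"
    using \<open>0 < t\<close> by (simp add: ennreal_less_iff)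
  moreover have "\<exists>x\<in>mspace X. mdist Y (f x) y < 3 * t" if y: "y \<in> mspace Y" for y
  proof -
    obtain x where "x \<in> mspace X" "d (Inl x) (Inr y) < t" using near'[OF y] by blast
    with dist_le[OF _ y, of x] \<open>0 < t\<close> show ?thesis by (intro bexI[of _ x]) auto
  qed
  ultimately have "eps_isometry (3 * t) L X \<alpha> Y \<beta> f"
    unfolding eps_isometry_def eps_net_def using fY by auto
  then show ?thesis by blast
qed

section \<open>Gluing two spaces along an approximate isometry\<close>

lemma LGH_distance_le_if_eps_isometry:
  fixes X :: "'a metric" and Y :: "'b metric"
  assumes ne: "mspace X \<noteq> {}" and \<alpha>: "\<alpha> \<in> L \<rightarrow> mspace X" and \<beta>: "\<beta> \<in> L \<rightarrow> mspace Y"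
    and "0 < \<epsilon>" and iso: "eps_isometry \<epsilon> L X \<alpha> Y \<beta> f"
  shows "LGH_distance L X \<alpha> Y \<beta> \<le> ennreal (2 * \<epsilon>)"
proof -
  have fY: "\<And>x. x \<in> mspace X \<Longrightarrow> f x \<in> mspace Y"
    and net: "\<And>y. y \<in> mspace Y \<Longrightarrow> \<exists>x\<in>mspace X. mdist Y (f x) y < \<epsilon>"
    using iso unfolding eps_isometry_def eps_net_def by auto
  have dis: "\<bar>mdist X x x' - mdist Y (f x) (f x')\<bar> \<le> \<epsilon>" if "x \<in> mspace X" "x' \<in> mspace X" for x x'
  proof -
    have "ennreal \<bar>mdist X x x' - mdist Y (f x) (f x')\<bar> \<le> distortion X Y f"
      unfolding distortion_def using that by (intro SUP_upper2[of "(x, x')"]) auto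
    also have "\<dots> < ennreal \<epsilon>" using iso unfolding eps_isometry_def by simp
    finally show ?thesis by (simp add: ennreal_less_iff)
  qed
  have lab: "mdist Y (f (\<alpha> l)) (\<beta> l) \<le> \<epsilon>" if "l \<in> L" for l
  proof -
    have "ennreal (mdist Y (f (\<alpha> l)) (\<beta> l)) \<le> (SUP l\<in>L. ennreal (mdist Y (f (\<alpha> l)) (\<beta> l)))"
      using that by (rule SUP_upper)
    also have "\<dots> < ennreal \<epsilon>" using iso unfolding eps_isometry_def by simp
    finally show ?thesis by (simp add: ennreal_less_iff)
  qed
  note tX = mdist_triangle[of _ X] and tY = mdist_triangle[of _ Y]
  \<comment> \<open>The infimal length of a path from \<open>x\<close> to \<open>y\<close> that
    crosses exactly one bridge. Further crossings would not shorten it, by \<open>X_g\<close> and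
    \<open>Y_g\<close> below. As a real infimum it needs a nonempty index set, given by
    \<open>ne\<close>, and a lower bound, here 0.\<close>
  define g where "g x y = (INF u\<in>mspace X. mdist X x u + \<epsilon> + mdist Y (f u) y)" for x y
  have g_le: "g x y \<le> mdist X x u + \<epsilon> + mdist Y (f u) y" if "u \<in> mspace X" for x y u
    unfolding g_def using that \<open>0 < \<epsilon>\<close>
    by (intro cINF_lower bdd_belowI2[where m = 0]) (auto intro!: add_nonneg_nonneg)
  have g_ge: "c \<le> g x y" if "\<And>u. u \<in> mspace X \<Longrightarrow> c \<le> mdist X x u + \<epsilon> + mdist Y (f u) y" for c x y
    unfolding g_def using ne that by (rule cINF_greatest)
  have g_nonneg: "0 \<le> g x y" for x y
    using \<open>0 < \<epsilon>\<close> by (intro g_ge) (auto intro!: add_nonneg_nonneg)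
  have g_X: "g x y \<le> mdist X x x' + g x' y" if "x \<in> mspace X" "x' \<in> mspace X" for x x' y
  proof -
    \<comment> \<open>Moving the fixed distance to the left leaves a constant below a single
      infimum, so that \<open>g_ge\<close> reduces the claim to one bridge \<open>u\<close>.\<close>
    have "g x y - mdist X x x' \<le> g x' y"
    proof (rule g_ge)
      fix u assume "u \<in> mspace X"
      with g_le[of u x y] tX[of x x' u] that
      show "g x y - mdist X x x' \<le> mdist X x' u + \<epsilon> + mdist Y (f u) y" by simp
    qed
    then show ?thesis by simp
  qed
  have g_Y: "g x y' \<le> g x y + mdist Y y y'" if "y \<in> mspace Y" "y' \<in> mspace Y" for x y y'
  proof -
    have "g x y' - mdist Y y y' \<le> g x y"
    proof (rule g_ge)
      fix u assume "u \<in> mspace X"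
      with g_le[of u x y'] tY[of "f u" y y'] fY[of u] that
      show "g x y' - mdist Y y y' \<le> mdist X x u + \<epsilon> + mdist Y (f u) y" by simp
    qed
    then show ?thesis by simp
  qed
  have X_g: "mdist X x x' \<le> g x y + g x' y"
    if "x \<in> mspace X" "x' \<in> mspace X" "y \<in> mspace Y" for x x' y
  proof -
    \<comment> \<open>Two uses of \<open>g_ge\<close> fix a bridge at \<open>u\<close> and one at
      \<open>v\<close>. The way from \<open>f u\<close> through \<open>y\<close> to
      \<open>f v\<close> may be shorter than \<open>mdist X u v\<close>, but by at most \<epsilon>,
      and the two bridges cost 2\<epsilon>.\<close>
    have "mdist X x x' - g x' y \<le> g x y"
    proof (rule g_ge)
      fix u assume u: "u \<in> mspace X"
      have "mdist X x x' - (mdist X x u + \<epsilon> + mdist Y (f u) y) \<le> g x' y"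
      proof (rule g_ge)
        fix v assume v: "v \<in> mspace X"
        from tX[of x u x'] tX[of u v x'] tY[of "f u" y "f v"] dis[of u v] \<open>0 < \<epsilon>\<close> fY[of u] fY[of v] u v that
        show "mdist X x x' - (mdist X x u + \<epsilon> + mdist Y (f u) y) \<le> mdist X x' v + \<epsilon> + mdist Y (f v) y"
          by (simp add: mdist_commute)
      qed
      then show "mdist X x x' - g x' y \<le> mdist X x u + \<epsilon> + mdist Y (f u) y" by simp
    qed
    then show ?thesis by simp
  qed
  have Y_g: "mdist Y y y' \<le> g x y + g x y'"
    if "y \<in> mspace Y" "y' \<in> mspace Y" "x \<in> mspace X" for x y y'
  proof -
    \<comment> \<open>The mirror image: the way from \<open>u\<close> through \<open>x\<close> to
      \<open>v\<close> undercuts \<open>mdist Y (f u) (f v)\<close> by at most \<epsilon>, which the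
      two bridges again outweigh.\<close>
    have "mdist Y y y' - g x y' \<le> g x y"
    proof (rule g_ge)
      fix u assume u: "u \<in> mspace X"
      have "mdist Y y y' - (mdist X x u + \<epsilon> + mdist Y (f u) y) \<le> g x y'"
      proof (rule g_ge)
        fix v assume v: "v \<in> mspace X"
        from tY[of y "f u" y'] tY[of "f u" "f v" y'] tX[of u x v] dis[of u v] \<open>0 < \<epsilon>\<close> fY[of u] fY[of v] u v that
        show "mdist Y y y' - (mdist X x u + \<epsilon> + mdist Y (f u) y) \<le> mdist X x v + \<epsilon> + mdist Y (f v) y'"
          by (simp add: mdist_commute)
      qed
      then show "mdist Y y y' - g x y' \<le> mdist X x u + \<epsilon> + mdist Y (f u) y" by simp
    qed
    then show ?thesis by simp
  qed
  define d where "d p q = (case (p, q) of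
      (Inl x, Inl x') \<Rightarrow> mdist X x x' | (Inr y, Inr y') \<Rightarrow> mdist Y y y'
    | (Inl x, Inr y) \<Rightarrow> g x y | (Inr y, Inl x) \<Rightarrow> g x y)" for p q
  have d_simps [simp]: "d (Inl x) (Inl x') = mdist X x x'" "d (Inr y) (Inr y') = mdist Y y y'"
      "d (Inl x) (Inr y) = g x y" "d (Inr y) (Inl x) = g x y" for x x' y y'
    by (simp_all add: d_def)
  have "d p r \<le> d p q + d q r"
    if "p \<in> mspace X <+> mspace Y" "q \<in> mspace X <+> mspace Y" "r \<in> mspace X <+> mspace Y" for p q r
    using that
  \<comment> \<open>Of the eight cases, the two written out traverse \<open>g_X\<close> or
    \<open>g_Y\<close> backwards and so need symmetry of the metric.\<close>
  proof (elim PlusE; hypsubst)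
    fix y x x' assume "y \<in> mspace Y" "x \<in> mspace X" "x' \<in> mspace X"
    with g_X[of x' x y] show "d (Inr y) (Inl x') \<le> d (Inr y) (Inl x) + d (Inl x) (Inl x')"
      by (simp add: mdist_commute)
  next
    fix y y' x assume "y \<in> mspace Y" "y' \<in> mspace Y" "x \<in> mspace X"
    with g_Y[of y' y x] show "d (Inr y) (Inl x) \<le> d (Inr y) (Inr y') + d (Inr y') (Inl x)"
      by (simp add: mdist_commute)
  qed (use g_X g_Y X_g Y_g tX tY in simp_all)
  then have pm: "pseudometric_on (mspace X <+> mspace Y) d"
    unfolding pseudometric_on_def by (auto simp: g_nonneg mdist_commute)
  have haus_X: "(INF b\<in>Inr ` mspace Y. ennreal (d (Inl x) b)) \<le> ennreal (2 * \<epsilon>)" if "x \<in> mspace X" for x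
    using g_le[OF that, of x "f x"] fY[OF that] \<open>0 < \<epsilon>\<close> that
    by (intro INF_lower2[of "Inr (f x)"] ennreal_leI) (auto simp: mdist_same)
  \<comment> \<open>Here the factor 2 arises: one \<epsilon> for the bridge at \<open>x\<close> and
    one for the net error from \<open>f x\<close> to \<open>y\<close>. For labels, the label error
    takes the place of the net error.\<close>
  have haus_Y: "(INF a\<in>Inl ` mspace X. ennreal (d a (Inr y))) \<le> ennreal (2 * \<epsilon>)" if y: "y \<in> mspace Y" for y
  proof -
    obtain x where "x \<in> mspace X" "mdist Y (f x) y < \<epsilon>" using net[OF y] by blast
    with g_le[of x x y] show ?thesis
      by (intro INF_lower2[of "Inl x"] ennreal_leI) (auto simp: mdist_same)
  qed
  have labels: "g (\<alpha> l) (\<beta> l) \<le> 2 * \<epsilon>" if "l \<in> L" for l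
  proof -
    have "\<alpha> l \<in> mspace X" using \<alpha> that by auto
    with g_le[of "\<alpha> l" "\<alpha> l" "\<beta> l"] lab[OF that] show ?thesis by (simp add: mdist_same)
  qed
  have "admissible (2 * \<epsilon>) L X \<alpha> Y \<beta> d"
    unfolding admissible_def hausdorff_distance_def
    using pm haus_X haus_Y labels by (auto intro!: SUP_least ennreal_leI)
  then show ?thesis
    unfolding LGH_distance_def using \<open>0 < \<epsilon>\<close> by (intro Inf_lower) auto
qed

section \<open>Bounded diameters and finiteness of the LGH distance\<close>

lemma compact_space_mdist_bounded:
  assumes "compact_space (mtopology_of X)"
  obtains B where "0 < B" "\<And>x y. x \<in> mspace X \<Longrightarrow> y \<in> mspace X \<Longrightarrow> mdist X x y \<le> B"
proof -
  interpret Metric_space "mspace X" "mdist X" by (rule Metric_space_mspace_mdist)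
  have "mbounded (mspace X)"
    using assms by (intro compactin_imp_mbounded) (simp add: compact_space_def mtopology_of_def)
  then show ?thesis using that unfolding mbounded_alt_pos by blast
qed

text \<open>A constant map is an isometry up to the diameters of the two spaces.\<close>

lemma labeled_metric_space_eps_isometry_exists:
  assumes "labeled_metric_space L X \<alpha>" and "labeled_metric_space L Y \<beta>"
  obtains \<epsilon> f where "0 < \<epsilon>" "eps_isometry \<epsilon> L X \<alpha> Y \<beta> f"
proof -
  obtain B where B: "0 < B" "\<And>x y. x \<in> mspace X \<Longrightarrow> y \<in> mspace X \<Longrightarrow> mdist X x y \<le> B"
    using assms(1) unfolding labeled_metric_space_def by (metis compact_space_mdist_bounded)
  obtain C where C: "0 < C" "\<And>x y. x \<in> mspace Y \<Longrightarrow> y \<in> mspace Y \<Longrightarrow> mdist Y x y \<le> C"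
    using assms(2) unfolding labeled_metric_space_def by (metis compact_space_mdist_bounded)
  obtain x0 y0 where x0: "x0 \<in> mspace X" and y0: "y0 \<in> mspace Y"
    using assms unfolding labeled_metric_space_def by blast
  have \<beta>: "\<beta> l \<in> mspace Y" if "l \<in> L" for l
    using assms(2) that unfolding labeled_metric_space_def by auto
  have "distortion X Y (\<lambda>_. y0) \<le> ennreal B"
    unfolding distortion_def using B y0 by (auto simp: mdist_same intro!: SUP_least ennreal_leI)
  also have "\<dots> < ennreal (B + C)" using B C by (simp add: ennreal_less_iff)
  finally have 1: "distortion X Y (\<lambda>_. y0) < ennreal (B + C)" .
  have "(SUP l\<in>L. ennreal (mdist Y y0 (\<beta> l))) \<le> ennreal C"
    using C y0 \<beta> by (auto intro!: SUP_least ennreal_leI)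
  also have "\<dots> < ennreal (B + C)" using B C by (simp add: ennreal_less_iff)
  finally have 2: "(SUP l\<in>L. ennreal (mdist Y y0 (\<beta> l))) < ennreal (B + C)" .
  have 3: "mdist Y y0 y < B + C" if "y \<in> mspace Y" for y
    using C(2)[OF y0 that] B(1) by linarith
  \<comment> \<open>\<open>B\<close> bounds the distortion and \<open>C\<close> the label and net
    errors. As both are positive, their sum exceeds each of them strictly.\<close>
  have "eps_isometry (B + C) L X \<alpha> Y \<beta> (\<lambda>_. y0)"
    unfolding eps_isometry_def eps_net_def using 1 2 3 x0 y0 by auto
  then show ?thesis using that[of "B + C"] B C by simp
qed

text \<open>Compactness enters here through the diameter bounds. Finiteness is what lets
  \<open>enn2real\<close> recover the distance faithfully, since it sends infinity to 0; convergence
  alone says nothing about the first terms of the sequence.\<close>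

lemma LGH_distance_finite:
  assumes "labeled_metric_space L X \<alpha>" and "labeled_metric_space L Y \<beta>"
  shows "LGH_distance L X \<alpha> Y \<beta> < \<infinity>"
proof -
  obtain \<epsilon> f where "0 < \<epsilon>" "eps_isometry \<epsilon> L X \<alpha> Y \<beta> f"
    using labeled_metric_space_eps_isometry_exists[OF assms] .
  then have "LGH_distance L X \<alpha> Y \<beta> \<le> ennreal (2 * \<epsilon>)"
    using assms unfolding labeled_metric_space_def by (blast intro: LGH_distance_le_if_eps_isometry)
  also have "\<dots> < \<infinity>" by simp
  finally show ?thesis .
qed

section \<open>Convergence in terms of approximate isometries\<close>

theorem corollary3p6:
  fixes L :: "'l set"
    and Xs :: "nat \<Rightarrow> 'a metric" and \<alpha>s :: "nat \<Rightarrow> 'l \<Rightarrow> 'a"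
    and X :: "'b metric" and \<alpha> :: "'l \<Rightarrow> 'b"
  assumes "\<And>n. labeled_metric_space L (Xs n) (\<alpha>s n)"
    and "labeled_metric_space L X \<alpha>"
  shows "(\<lambda>n. LGH_distance L (Xs n) (\<alpha>s n) X \<alpha>) \<longlonglongrightarrow> 0 \<longleftrightarrow>
    (\<exists>(\<epsilon> :: nat \<Rightarrow> real) (f :: nat \<Rightarrow> 'a \<Rightarrow> 'b).
       (\<forall>n. 0 < \<epsilon> n) \<and>
       (\<forall>n. eps_isometry (\<epsilon> n) L (Xs n) (\<alpha>s n) X \<alpha> (f n)) \<and>
       \<epsilon> \<longlonglongrightarrow> 0)"
    (is "?\<rho> \<longlonglongrightarrow> 0 \<longleftrightarrow> ?isometries")
proof -
  have \<alpha>: "\<alpha> \<in> L \<rightarrow> mspace X" and \<alpha>s: "\<alpha>s n \<in> L \<rightarrow> mspace (Xs n)"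
    and ne: "mspace (Xs n) \<noteq> {}" for n
    using assms unfolding labeled_metric_space_def by auto
  show ?thesis
  proof
    assume lim: "?\<rho> \<longlonglongrightarrow> 0"
    \<comment> \<open>The added null sequence keeps \<open>t n\<close> positive and strictly above
      the distance, even where the distance is 0. \<open>Suc\<close> keeps the added term positive
      at \<open>n = 0\<close>.\<close>
    define t where "t n = enn2real (?\<rho> n) + inverse (real (Suc n))" for n
    have t_pos: "0 < t n" for n
      unfolding t_def by (simp add: add_nonneg_pos)
    have "?\<rho> n < ennreal (t n)" for n
    proof -
      have "?\<rho> n = ennreal (enn2real (?\<rho> n))"
        using LGH_distance_finite[OF assms(1) assms(2), of n] by simp
      also have "\<dots> < ennreal (t n)"
        unfolding t_def by (intro ennreal_lessI) (simp_all add: add_nonneg_pos)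
      finally show ?thesis .
    qed
    then have "\<forall>n. \<exists>f. eps_isometry (3 * t n) L (Xs n) (\<alpha>s n) X \<alpha> f"
      using eps_isometry_if_LGH_distance_less[OF \<alpha>s \<alpha>] by blast
    then obtain f where "\<And>n. eps_isometry (3 * t n) L (Xs n) (\<alpha>s n) X \<alpha> (f n)"
      by metis
    moreover have "(\<lambda>n. 3 * t n) \<longlonglongrightarrow> 0"
    proof -
      have "(\<lambda>n. enn2real (?\<rho> n)) \<longlonglongrightarrow> 0"
        using tendsto_enn2real[of ?\<rho> 0] lim by simp
      from tendsto_mult_right_zero[OF tendsto_add_zero[OF this LIMSEQ_inverse_real_of_nat]]
      show ?thesis unfolding t_def .
    qed
    ultimately show ?isometries
      using t_pos by (intro exI[of _ "\<lambda>n. 3 * t n"] exI[of _ f]) simp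
  next
    assume ?isometries
    then obtain \<epsilon> f where pos: "\<And>n. 0 < \<epsilon> n" and lim: "\<epsilon> \<longlonglongrightarrow> 0"
      and iso: "\<And>n. eps_isometry (\<epsilon> n) L (Xs n) (\<alpha>s n) X \<alpha> (f n)"
      by blast
    have le: "?\<rho> n \<le> ennreal (2 * \<epsilon> n)" for n
      using ne \<alpha>s \<alpha> pos iso by (rule LGH_distance_le_if_eps_isometry)
    have "(\<lambda>n. ennreal (2 * \<epsilon> n)) \<longlonglongrightarrow> 0"
      using tendsto_ennrealI[OF tendsto_mult_right_zero[OF lim, of 2]] by simp
    \<comment> \<open>Squeezed between the constant 0, a lower bound for free in
      \<open>ennreal\<close>, and 2\<epsilon>.\<close>
    then show "?\<rho> \<longlonglongrightarrow> 0"
      by (rule tendsto_sandwich[OF _ _ tendsto_const, rotated 2]) (simp_all add: le)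
  qed
qed

end
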